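(* Let $G=(V,E)$ be a graph that may have self-loops but has no parallel edges, let $\mathcal{T}$ be a set of triangles in $G$, and let $A_1, A_2\subseteq E$ be $\mathcal{T}$-free 2-matchings in $G$. Then there exists a partition $\mathcal{P}$ of $A_1 \bigtriangleup A_2$ into alternating trails with respect to $(A_1, A_2)$ such that $A_i \bigtriangleup P$ is a $\mathcal{T}$-free 2-matching for $i=1,2$ and for every $P\in\mathcal{P}$.
   Context: For $F\subseteq E$ and $v\in V$, $d_F(v)$ is the number of edges of $F$ incident to $v$, where a self-loop at $v$ is counted twice. A 2-matching is an edge set $M\subseteq E$ with $d_M(v)\le 2$ for all $v\in V$. A triangle is an edge set forming a cycle of length $3$ (on three distinct vertices). Given a set $\mathcal{T}$ of triangles, an edge set $F$ is $\mathcal{T}$-free if it contains no triangle $T\in\mathcal{T}$ as a subset. A trail is a sequence of distinct consecutive edges $u_1u_2, u_2u_3, \dots, u_ku_{k+1}$ (the vertices $u_j$ need not be distinct), identified with its edge set when convenient. For 2-matchings $A_1, A_2$, a trail is alternating with respect to $(A_1,A_2)$ if it traverses edges of $A_1\setminus A_2$ and $A_2\setminus A_1$ alternately. $\bigtriangleup$ denotes symmetric difference. *)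

theory Defs
  imports Main "HOL-Library.Disjoint_Sets"
begin

text \<open>An edge is the set of its end vertices: \<^term>\<open>{u, v}\<close> with \<^prop>\<open>u \<noteq> v\<close> for an ordinary
  edge, the singleton \<^term>\<open>{v}\<close> for a self-loop at \<^term>\<open>v\<close>. Since the edges form a set,
  there are no parallel edges and no repeated loops.\<close>

definition is_graph :: "'v set \<Rightarrow> 'v set set \<Rightarrow> bool" where
  "is_graph V E \<longleftrightarrow> finite V \<and> E \<subseteq> {{u, v} | u v. u \<in> V \<and> v \<in> V}"

text \<open>A self-loop at \<^term>\<open>v\<close> is counted by both summands.\<close>

definition deg :: "'v set set \<Rightarrow> 'v \<Rightarrow> nat" where
  "deg F v = card {e \<in> F. v \<in> e} + card {e \<in> F. e = {v}}"

definition two_matching :: "'v set \<Rightarrow> 'v set set \<Rightarrow> 'v set set \<Rightarrow> bool" where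
  "two_matching V E M \<longleftrightarrow> M \<subseteq> E \<and> (\<forall>v\<in>V. deg M v \<le> 2)"

definition is_triangle :: "'v set set \<Rightarrow> 'v set set \<Rightarrow> bool" where
  "is_triangle E T \<longleftrightarrow>
     T \<subseteq> E \<and> (\<exists>a b c. distinct [a, b, c] \<and> T = {{a, b}, {b, c}, {c, a}})"

definition tri_free :: "'v set set set \<Rightarrow> 'v set set \<Rightarrow> bool" where
  "tri_free \<T> F \<longleftrightarrow> (\<forall>T\<in>\<T>. \<not> T \<subseteq> F)"

fun walk_edges :: "'v list \<Rightarrow> 'v set list" where
  "walk_edges (u # v # us) = {u, v} # walk_edges (v # us)"
| "walk_edges _ = []"

text \<open>A trail is given by its vertex sequence \<open>u\<^sub>1, \<dots>, u\<^sub>k\<^sub>+\<^sub>1\<close> with \<open>k \<ge> 1\<close>.\<close>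

definition is_trail :: "'v set set \<Rightarrow> 'v list \<Rightarrow> bool" where
  "is_trail E us \<longleftrightarrow>
     length us \<ge> 2 \<and> set (walk_edges us) \<subseteq> E \<and> distinct (walk_edges us)"

text \<open>For a closed trail, the last and the first edge are not required to alternate.\<close>

definition alternating :: "'v set set \<Rightarrow> 'v set set \<Rightarrow> 'v list \<Rightarrow> bool" where
  "alternating A\<^sub>1 A\<^sub>2 us \<longleftrightarrow>
     set (walk_edges us) \<subseteq> (A\<^sub>1 - A\<^sub>2) \<union> (A\<^sub>2 - A\<^sub>1) \<and>
     successively (\<lambda>e f. (e \<in> A\<^sub>1 - A\<^sub>2 \<and> f \<in> A\<^sub>2 - A\<^sub>1) \<or> (e \<in> A\<^sub>2 - A\<^sub>1 \<and> f \<in> A\<^sub>1 - A\<^sub>2))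
       (walk_edges us)"

definition alternating_trail_set ::
  "'v set set \<Rightarrow> 'v set set \<Rightarrow> 'v set set \<Rightarrow> 'v set set \<Rightarrow> bool" where
  "alternating_trail_set E A\<^sub>1 A\<^sub>2 P \<longleftrightarrow>
     (\<exists>us. is_trail E us \<and> alternating A\<^sub>1 A\<^sub>2 us \<and> P = set (walk_edges us))"

end

theory Submission
  imports Defs
begin

text \<open>
  Call the edges of \<open>A\<^sub>1 - A\<^sub>2\<close> red and those of \<open>A\<^sub>2 - A\<^sub>1\<close> blue. A triangle can become
  part of some \<open>A\<^sub>i \<triangle> P\<close> only if it has edges of both colours and no trail contains both a red and
  a blue edge of it; so it suffices to find alternating trails such that every bichromatic triangle has
  a red and a blue edge on a common trail. This condition survives concatenation of trails, hence one may
  assume that no two trails can be concatenated, and then the excess of blue over red ends of a trail at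
  a vertex is at most the total excess, which gives the degree bounds.

  To find the trails, link a red and a blue edge of each bichromatic triangle at a common vertex, so that
  each edge is linked at most once at each of its ends. A triangle with base \<open>ab\<close> of one colour and sides
  \<open>ax, bx\<close> of the other can be linked at \<open>a\<close> or at \<open>b\<close>. Two triangles compete only if they share their
  base, or if the base of one is a side of the other. A local rule resolves all these conflicts, except
  in one configuration on five vertices (\<open>K\<^sub>5\<close> with at most one edge missing), whose edges are instead
  linked into a single trail.
\<close>

section \<open>Linking bichromatic triangles\<close>

text \<open>A well-order of the type supplies the relation, since the vertices carry no order of
  their own.\<close>

lemma ex_tournament: "\<exists>lt :: 'a \<Rightarrow> 'a \<Rightarrow> bool. \<forall>a b. a \<noteq> b \<longrightarrow> (lt a b \<longleftrightarrow> \<not> lt b a)"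
proof -
  obtain r :: "'a rel" where "well_order_on UNIV r"
    using well_order_on by blast
  then have "total r" "antisym r"
    by (auto simp: well_order_on_def linear_order_on_def partial_order_on_def)
  then have "\<forall>a b. a \<noteq> b \<longrightarrow> ((a, b) \<in> r \<longleftrightarrow> (b, a) \<notin> r)"
    by (auto simp: total_on_def antisym_def)
  then show ?thesis by (rule exI[where x = "\<lambda>a b. (a, b) \<in> r"])
qed

text \<open>\<open>F k\<close> is adjacency in colour \<open>k\<close>. With the colour as an
  argument, every lemma also covers the situation with the colours exchanged.\<close>

locale two_coloured =
  fixes F :: "bool \<Rightarrow> 'v \<Rightarrow> 'v \<Rightarrow> bool"
  assumes sym: "F k a b \<Longrightarrow> F k b a"
    and irrefl: "\<not> F k a a"
    and disj: "F k a b \<Longrightarrow> \<not> F (\<not> k) a b"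
    and deg2: "F k v a \<Longrightarrow> F k v b \<Longrightarrow> F k v c \<Longrightarrow> a = b \<or> a = c \<or> b = c"
begin

definition tri :: "bool \<Rightarrow> 'v \<Rightarrow> 'v \<Rightarrow> 'v \<Rightarrow> bool" where
  "tri k a b x \<longleftrightarrow> F k a b \<and> F (\<not> k) a x \<and> F (\<not> k) b x"

text \<open>For an edge \<open>ab\<close> of colour \<open>k\<close>: it is a side of a triangle with apex \<open>a\<close>. If \<open>ab\<close> is also the
  base of a triangle, then linking that triangle at \<open>a\<close> avoids the conflict between the two.\<close>

definition apex :: "bool \<Rightarrow> 'v \<Rightarrow> 'v \<Rightarrow> bool" where
  "apex k a b \<longleftrightarrow> (\<exists>y. tri (\<not> k) b y a)"

definition bi_apex :: "bool \<Rightarrow> 'v \<Rightarrow> 'v \<Rightarrow> bool" where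
  "bi_apex k a b \<longleftrightarrow> (\<exists>x. tri k a b x) \<and> apex k a b \<and> apex k b a"

text \<open>The rule for linking the triangle with base \<open>ab\<close> and apex \<open>x\<close> at \<open>a\<close>. It allows both ends in some
  cases. The tournament \<open>lt\<close> breaks the tie between two triangles with the same base.\<close>

definition picks :: "('v \<Rightarrow> 'v \<Rightarrow> bool) \<Rightarrow> bool \<Rightarrow> 'v \<Rightarrow> 'v \<Rightarrow> 'v \<Rightarrow> bool" where
  "picks lt k a b x \<longleftrightarrow> tri k a b x \<and>
     (if apex k b a then apex k a b \<and> (\<forall>t. F k b t \<longrightarrow> t \<noteq> a \<longrightarrow> \<not> F k x t)
      else apex k a b \<or>
        \<not> bi_apex (\<not> k) a x \<and>
        (\<forall>x'. tri k a b x' \<longrightarrow> x' \<noteq> x \<longrightarrow> \<not> bi_apex (\<not> k) b x' \<and>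
           (bi_apex (\<not> k) b x \<or> bi_apex (\<not> k) a x' \<or> (lt a b \<longleftrightarrow> lt x x'))))"

text \<open>The only configuration in which \<open>picks\<close> may allow neither end: a 5-cycle of colour \<open>k\<close> together with
  the path \<open>s, q, y, p, t\<close> of the other colour.\<close>

definition pent :: "bool \<Rightarrow> 'v \<Rightarrow> 'v \<Rightarrow> 'v \<Rightarrow> 'v \<Rightarrow> 'v \<Rightarrow> bool" where
  "pent k y s p q t \<longleftrightarrow> F k y s \<and> F k s p \<and> F k p q \<and> F k q t \<and> F k t y \<and>
     F (\<not> k) s q \<and> F (\<not> k) q y \<and> F (\<not> k) y p \<and> F (\<not> k) p t"

section \<open>The local rule: absence of conflicts and existence of a choice\<close>

lemma tri_commute: "tri k a b x \<longleftrightarrow> tri k b a x"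
  unfolding tri_def using sym by blast

lemma tri_distinct: "tri k a b x \<Longrightarrow> a \<noteq> b \<and> a \<noteq> x \<and> b \<noteq> x"
  unfolding tri_def using irrefl by blast

text \<open>The apexes \<open>x\<close> and \<open>x'\<close> exhaust the neighbours of
  \<open>b\<close> in the other colour, and both are joined to \<open>a\<close> in that colour. A
  triangle witnessing \<open>apex k a b\<close> needs such a neighbour joined to \<open>a\<close> in
  colour \<open>k\<close>.\<close>

lemma twin_not_apex:
  assumes "tri k a b x" "tri k a b x'" "x \<noteq> x'"
  shows "\<not> apex k a b"
  using assms unfolding tri_def apex_def not_not
  by (metis deg2 disj sym not_not)

text \<open>The edge \<open>va\<close> is the base of one triangle and a side of another. The first
  choice makes \<open>va\<close> a \<open>bi_apex\<close> edge, which the second tolerates only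
  under \<open>apex (\<not> k) v c\<close>. The third vertex for that would have to be
  \<open>b\<close>, but \<open>bc\<close> lacks colour \<open>k\<close>.\<close>

lemma picks_sitting_false:
  assumes "picks lt k v a b" "picks lt (\<not> k) v c a"
  shows False
proof -
  have T1: "F k v a" "F (\<not> k) v b" "F (\<not> k) a b"
    and T2: "F (\<not> k) v c" "F k v a" "F k c a"
    using assms unfolding picks_def tri_def by auto
  have 1: "apex k a v"
    using T2 sym unfolding apex_def tri_def by auto
  \<comment> \<open>\<open>apex k a v\<close> activates the first branch of the rule, which is used
    with \<open>t = c\<close>.\<close>
  then have 2: "apex k v a" "\<not> F k b c"
    using assms(1) T2 T1 irrefl sym disj unfolding picks_def by (metis, metis)
  have bi: "bi_apex k v a"
    unfolding bi_apex_def using 1 2 assms(1) picks_def by auto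
  have "\<not> apex (\<not> k) v c"
  proof
    assume "apex (\<not> k) v c"
    then obtain z where z: "F k c z" "F (\<not> k) c v" "F (\<not> k) z v"
      unfolding apex_def tri_def by auto
    then have "z = b"
      using deg2[of "\<not>k" v z b c] T1 T2 sym irrefl disj by metis
    then show False using z 2 sym by blast
  qed
  then show False using assms(2) bi unfolding picks_def by (auto split: if_splits)
qed

text \<open>By \<open>twin_not_apex\<close> both choices fall into the last branch of the rule.
  There each one rules out the \<open>bi_apex\<close> exceptions of the other, so
  \<open>lt v a\<close> has to agree with both \<open>lt b c\<close> and
  \<open>lt c b\<close>.\<close>

lemma picks_twin_false:
  assumes "picks lt k v a b" "picks lt k v a c" "b \<noteq> c"
    and lt: "\<And>a b. a \<noteq> b \<Longrightarrow> lt a b \<longleftrightarrow> \<not> lt b a"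
  shows False
proof -
  have t: "tri k v a b" "tri k v a c" using assms unfolding picks_def by auto
  then have n: "\<not> apex k v a" "\<not> apex k a v"
    using twin_not_apex assms(3) tri_commute by metis+
  have "lt v a \<longleftrightarrow> lt x y" if "{x, y} = {b, c}" "x \<noteq> y" for x y
  proof -
    have p: "picks lt k v a x" "picks lt k v a y" "tri k v a x" "tri k v a y"
      using that assms(1,2) t by (auto simp: doubleton_eq_iff)
    from p(2) n p(3) that(2) have "\<not> bi_apex (\<not> k) v y" "\<not> bi_apex (\<not> k) a x"
      unfolding picks_def by simp_all
    with p(1) n p(4) that(2) show ?thesis
      unfolding picks_def by simp metis
  qed
  from this[of b c] this[of c b] show False
    using lt[of b c] assms(3) by auto
qed

text \<open>Otherwise the common apex \<open>a\<close> would have the three neighbours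
  \<open>v\<close>, \<open>b\<close>, \<open>c\<close> in one colour.\<close>

lemma picks_base_unique:
  assumes "picks lt k v b a" "picks lt k v c a"
  shows "b = c"
  using assms unfolding picks_def tri_def by (metis deg2 irrefl sym)

text \<open>The degree of \<open>x\<close> in colour \<open>k\<close> forces the apex
  \<open>y\<close> over \<open>ax\<close> to equal \<open>w'\<close>, the third vertex of the
  triangle with side \<open>bx\<close> and apex \<open>b\<close>. Then the triangle with base
  \<open>by\<close> and apex \<open>a\<close> is the witness.\<close>

lemma bi_apex_both_sides:
  assumes "tri k a b x" "bi_apex (\<not> k) a x" "bi_apex (\<not> k) b x"
  shows "apex k a b"
proof -
  obtain y w where a: "F (\<not> k) a x" "F k a y" "F k x y" "F k x w" "F (\<not> k) w a"
    using assms(2) unfolding bi_apex_def apex_def tri_def by auto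
  obtain y' w' where b: "F (\<not> k) b x" "F k b y'" "F k x y'" "F k x w'" "F (\<not> k) w' b"
    using assms(3) unfolding bi_apex_def apex_def tri_def by auto
  have ab: "F k a b" using assms(1) unfolding tri_def by auto
  have "y \<noteq> y'" using deg2[of k y a b x] a b assms(1) sym tri_distinct by metis
  moreover have "w' \<noteq> y'" using b disj sym by metis
  ultimately have "y = w'" using deg2[of k x y y' w'] a b by metis
  then have "tri (\<not> k) b y a" using a b ab sym unfolding tri_def by simp
  then show ?thesis unfolding apex_def by blast
qed

text \<open>The apexes over \<open>ax\<close> and \<open>ax'\<close> coincide by the degree at
  \<open>a\<close>; this vertex would then have the neighbours \<open>a\<close>, \<open>x\<close>,
  \<open>x'\<close> in colour \<open>k\<close>.\<close>

lemma bi_apex_twin_false: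
  assumes "tri k a b x" "tri k a b x'" "x \<noteq> x'" "bi_apex (\<not> k) a x" "bi_apex (\<not> k) a x'"
  shows False
proof -
  obtain y where a: "F (\<not> k) a x" "F k a y" "F k x y" 
    using assms(4) unfolding bi_apex_def apex_def tri_def by auto
  obtain y' where b: "F (\<not> k) a x'" "F k a y'" "F k x' y'" 
    using assms(5) unfolding bi_apex_def apex_def tri_def by auto
  have c: "F k a b" "F (\<not> k) b x" "F (\<not> k) b x'" using assms(1,2) unfolding tri_def by auto
  have "y = y'" using deg2[of k a b y y'] a b c disj sym by metis
  moreover have "y \<noteq> b" using a c disj sym by metis
  ultimately show False
    using deg2[of k y a x x'] a b assms(3) sym irrefl by metis
qed

text \<open>If \<open>apex\<close> holds at exactly one end, the rule links there; if at both, it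
  can fail only in a pentagon; if at neither, the two preceding lemmas leave an admissible
  end.\<close>

lemma picks_exists:
  assumes "tri k a b x" and free: "\<And>k y s p q t. \<not> pent k y s p q t"
    and lt: "\<And>a b. a \<noteq> b \<Longrightarrow> lt a b \<longleftrightarrow> \<not> lt b a"
  shows "picks lt k a b x \<or> picks lt k b a x"
proof (cases "apex k a b \<or> apex k b a")
  case True
  show ?thesis
  proof (cases "apex k a b \<and> apex k b a")
    case True
    \<comment> \<open>\<open>t\<close> and \<open>s\<close> obstruct linking at \<open>a\<close> and
      at \<open>b\<close>. The degrees at \<open>b\<close> and \<open>a\<close> identify them with
      the third vertices of the \<open>apex\<close> triangles, which completes the pentagon.\<close>
    have False if h: "F k b t" "t \<noteq> a" "F k x t" "F k a s" "s \<noteq> b" "F k x s" for s t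
    proof -
      obtain z where z: "F (\<not> k) b z" "F k b a" "F k z a"
        using True unfolding apex_def tri_def by auto
      obtain z' where z': "F (\<not> k) a z'" "F k a b" "F k z' b"
        using True unfolding apex_def tri_def by auto
      have "z = s" using deg2[of k a b z s] z h irrefl sym by metis
      moreover have "z' = t" using deg2[of k b a z' t] z' h irrefl sym by metis
      ultimately have "pent k x s a b t"
        using assms(1) z z' h sym unfolding pent_def tri_def by blast
      then show False using free by blast
    qed
    then show ?thesis using True assms(1) tri_commute unfolding picks_def by (smt (verit))
  next
    case False
    then show ?thesis using True assms(1) tri_commute unfolding picks_def by (smt (verit))
  qed
next
  case False
  have neither: "\<not> apex k a b" "\<not> apex k b a" using False by auto
  let ?B = "bi_apex (\<not> k)"
  have one: "\<not> (?B a z \<and> ?B b z)" if "tri k a b z" for z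
    using bi_apex_both_sides neither that by blast
  show ?thesis
  proof (cases "\<exists>x'. tri k a b x' \<and> x' \<noteq> x")
    case True
    then obtain x' where x': "tri k a b x'" "x' \<noteq> x" by blast
    \<comment> \<open>The degree at \<open>a\<close> admits at most two apexes over
      \<open>ab\<close>, so the tie-break concerns only \<open>x\<close> and
      \<open>x'\<close>.\<close>
    have u: "z = x'" if "tri k a b z" "z \<noteq> x" for z
      using deg2[of "\<not>k" a x x' z] that x' assms(1) unfolding tri_def by metis
    have "\<not> (?B a x \<and> ?B a x')" "\<not> (?B b x \<and> ?B b x')"
      using bi_apex_twin_false assms(1) x' tri_commute by metis+
    then show ?thesis
      using one[OF assms(1)] one[OF x'(1)] neither assms(1) tri_commute[of k a b] u x'
        lt[of a b] lt[of x x'] tri_distinct[OF assms(1)]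
      unfolding picks_def by (smt (verit))
  next
    case False
    then show ?thesis
      using one[OF assms(1)] neither assms(1) tri_commute[of k a b]
      unfolding picks_def by (smt (verit))
  qed
qed

end

section \<open>Link relations that cover all bichromatic triangles\<close>

definition adjoins :: "('v \<Rightarrow> 'v \<Rightarrow> 'v \<Rightarrow> bool) \<Rightarrow> 'v set \<Rightarrow> 'v set \<Rightarrow> bool" where
  "adjoins K e f \<longleftrightarrow> (\<exists>v a b. K v a b \<and> e = {v, a} \<and> f = {v, b})"

text \<open>\<open>K v a b\<close> says that the edges \<open>va\<close> and \<open>vb\<close> are consecutive at \<open>v\<close> on a trail.\<close>

definition linking :: "(bool \<Rightarrow> 'v \<Rightarrow> 'v \<Rightarrow> bool) \<Rightarrow> ('v \<Rightarrow> 'v \<Rightarrow> 'v \<Rightarrow> bool) \<Rightarrow> bool" where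
  "linking F K \<longleftrightarrow>
     (\<forall>v a b. K v a b \<longrightarrow> K v b a \<and> (\<exists>k. F k v a \<and> F (\<not> k) v b)) \<and>
     (\<forall>v a b c. K v a b \<longrightarrow> K v a c \<longrightarrow> b = c)"

context two_coloured
begin

lemma colour_unique: "F k a b \<Longrightarrow> F l a b \<Longrightarrow> k = l"
  using disj[of k a b] by (cases k; cases l) auto

text \<open>Chains of links are allowed because, inside the five-vertex configuration, two edges of
  a triangle may be joined only through further edges.\<close>

definition triangle_linked :: "('v \<Rightarrow> 'v \<Rightarrow> 'v \<Rightarrow> bool) \<Rightarrow> bool" where
  "triangle_linked K \<longleftrightarrow> (\<forall>k a b x. tri k a b x \<longrightarrow>
     (adjoins K)\<^sup>*\<^sup>* {a, b} {a, x} \<or> (adjoins K)\<^sup>*\<^sup>* {a, b} {b, x})"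

lemma pent_free_linking:
  assumes free: "\<And>k y s p q t. \<not> pent k y s p q t"
  shows "\<exists>K. linking F K \<and> triangle_linked K"
proof -
  obtain lt :: "'v \<Rightarrow> 'v \<Rightarrow> bool" where lt: "\<And>a b. a \<noteq> b \<Longrightarrow> lt a b \<longleftrightarrow> \<not> lt b a"
    using ex_tournament by metis
  define K where "K v a b \<longleftrightarrow> (\<exists>k. picks lt k v a b \<or> picks lt k v b a)" for v a b
  have F: "F k v a \<and> F (\<not> k) v b" if "picks lt k v a b" for k v a b
    using that unfolding picks_def tri_def by auto
  have "b = c" if K: "K v a b" "K v a c" for v a b c
  proof -
    obtain k where "picks lt k v a b \<or> picks lt k v b a"
      using K(1) unfolding K_def by blast
    moreover obtain l where "picks lt l v a c \<or> picks lt l v c a"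
      using K(2) unfolding K_def by blast
    \<comment> \<open>In each of the two triangles \<open>va\<close> is base or side: twin bases,
      two mixed cases, a shared apex.\<close>
    ultimately consider "picks lt k v a b" "picks lt l v a c" | "picks lt k v a b" "picks lt l v c a"
      | "picks lt k v b a" "picks lt l v a c" | "picks lt k v b a" "picks lt l v c a" by blast
    then show ?thesis
    proof cases
      case 1
      then have "k = l" using F colour_unique by blast
      then show ?thesis using 1 picks_twin_false[of lt k v a b c] lt by blast
    next
      case 2
      then have "l = (\<not> k)" using F colour_unique by blast
      then show ?thesis using 2 picks_sitting_false by blast
    next
      case 3
      then have "k = (\<not> l)" using F colour_unique by blast
      then show ?thesis using 3 picks_sitting_false by blast
    next
      case 4
      then have "k = l" using F colour_unique by blast
      then show ?thesis using 4 picks_base_unique by blast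
    qed
  qed
  moreover have "K v b a \<and> (\<exists>k. F k v a \<and> F (\<not> k) v b)" if "K v a b" for v a b
  proof
    show "K v b a" using that unfolding K_def by blast
    obtain k where "picks lt k v a b \<or> picks lt k v b a"
      using \<open>K v a b\<close> unfolding K_def by blast
    then have "F k v a \<and> F (\<not> k) v b \<or> F (\<not> k) v a \<and> F (\<not> \<not> k) v b"
      using F[of k v a b] F[of k v b a] by auto
    then show "\<exists>k. F k v a \<and> F (\<not> k) v b" by blast
  qed
  ultimately have "linking F K" unfolding linking_def by blast
  moreover have "triangle_linked K"
    unfolding triangle_linked_def
  proof (intro allI impI)
    fix k a b x assume "tri k a b x"
    then have "picks lt k a b x \<or> picks lt k b a x" using free lt by (rule picks_exists)
    then have "K a b x \<or> K b a x" unfolding K_def by blast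
    then have "adjoins K {a, b} {a, x} \<or> adjoins K {b, a} {b, x}"
      unfolding adjoins_def by blast
    then show "(adjoins K)\<^sup>*\<^sup>* {a, b} {a, x} \<or> (adjoins K)\<^sup>*\<^sup>* {a, b} {b, x}"
      by (auto simp: insert_commute)
  qed
  ultimately show ?thesis by blast
qed

section \<open>The five-vertex configuration\<close>

text \<open>The listed edges use up both colours at every vertex, except that \<open>s\<close> and
  \<open>t\<close> have room for one more edge of colour \<open>\<not> k\<close>.\<close>

lemma pent_nbrs:
  assumes "pent k y s p q t"
  shows "distinct [y, s, p, q, t]"
    and "F k y z \<longleftrightarrow> z = s \<or> z = t" and "F k s z \<longleftrightarrow> z = y \<or> z = p"
    and "F k p z \<longleftrightarrow> z = s \<or> z = q" and "F k q z \<longleftrightarrow> z = p \<or> z = t"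
    and "F k t z \<longleftrightarrow> z = q \<or> z = y"
    and "F (\<not> k) y z \<longleftrightarrow> z = p \<or> z = q" and "F (\<not> k) p z \<longleftrightarrow> z = y \<or> z = t"
    and "F (\<not> k) q z \<longleftrightarrow> z = s \<or> z = y"
    and "F (\<not> k) s q" and "F (\<not> k) t p"
proof -
  have e: "F k y s" "F k s p" "F k p q" "F k q t" "F k t y" "F (\<not> k) s q" "F (\<not> k) q y"
    "F (\<not> k) y p" "F (\<not> k) p t"
    "F k s y" "F k p s" "F k q p" "F k t q" "F k y t" "F (\<not> k) q s" "F (\<not> k) y q"
    "F (\<not> k) p y" "F (\<not> k) t p"
    using assms sym unfolding pent_def by auto
  show d: "distinct [y, s, p, q, t]"
  proof -
    have "a \<noteq> b" if "F l a b" for l a b using that irrefl by metis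
    moreover have "s \<noteq> t" using disj[OF e(2)] e(18) by metis
    ultimately show ?thesis using e by auto
  qed
  have full: "F l v z \<longleftrightarrow> z = a \<or> z = b" if "F l v a" "F l v b" "a \<noteq> b" for l v a b z
    using deg2 that by metis
  show "F k y z \<longleftrightarrow> z = s \<or> z = t" "F k s z \<longleftrightarrow> z = y \<or> z = p"
     "F k p z \<longleftrightarrow> z = s \<or> z = q" "F k q z \<longleftrightarrow> z = p \<or> z = t"
     "F k t z \<longleftrightarrow> z = q \<or> z = y"
     "F (\<not> k) y z \<longleftrightarrow> z = p \<or> z = q" "F (\<not> k) p z \<longleftrightarrow> z = y \<or> z = t"
     "F (\<not> k) q z \<longleftrightarrow> z = s \<or> z = y"
    by (rule full; use e d in auto)+
  show "F (\<not> k) s q" "F (\<not> k) t p" by fact+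
qed

end

lemma adjoins_mono: "(\<And>v a b. K v a b \<Longrightarrow> L v a b) \<Longrightarrow> (adjoins K)\<^sup>*\<^sup>* e f \<Longrightarrow> (adjoins L)\<^sup>*\<^sup>* e f"
  by (rule rtranclp_mono[THEN predicate2D, rotated]) (unfold adjoins_def, blast+)

lemma adjoins_sym:
  assumes "\<And>v a b. K v a b \<Longrightarrow> K v b a" "(adjoins K)\<^sup>*\<^sup>* e f"
  shows "(adjoins K)\<^sup>*\<^sup>* f e"
proof -
  have "symp (adjoins K)" using assms(1) unfolding adjoins_def symp_def by blast
  then show ?thesis using assms(2) by (meson sympD symp_rtranclp)
qed

text \<open>Edges inside the configuration are linked by \<open>L\<close>, all others by
  \<open>K'\<close>. A triangle with one edge inside lies entirely inside, so each triangle is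
  served by one of the two.\<close>

lemma (in two_coloured) pent_split:
  assumes X: "pent k y s p q t"
    and K': "linking (\<lambda>l a b. F l a b \<and> \<not> {a, b} \<subseteq> {y, s, p, q, t}) K'"
    and tri': "\<And>l a b x. tri l a b x \<Longrightarrow> \<not> {a, b} \<subseteq> {y, s, p, q, t} \<Longrightarrow>
      \<not> {a, x} \<subseteq> {y, s, p, q, t} \<Longrightarrow> \<not> {b, x} \<subseteq> {y, s, p, q, t} \<Longrightarrow>
      (adjoins K')\<^sup>*\<^sup>* {a, b} {a, x} \<or> (adjoins K')\<^sup>*\<^sup>* {a, b} {b, x}"
  shows "\<exists>K. linking F K \<and> triangle_linked K"
proof -
  let ?X = "{y, s, p, q, t}"
  note nb = pent_nbrs[OF X]
  \<comment> \<open>In \<open>(v, a, b)\<close> the edge \<open>va\<close> has colour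
    \<open>k\<close> and \<open>vb\<close> the other one. The optional part uses \<open>st\<close>,
    if present, to join the two ends of the trail.\<close>
  define L where "L = {(p, s, y), (p, q, t), (y, s, p), (y, t, q), (s, y, q), (q, t, s), (q, p, y),
    (t, q, p)} \<union> {(v, a, b). F (\<not> k) s t \<and> (v, a, b) \<in> {(s, p, t), (t, y, s)}}"
  define K where "K v a b \<longleftrightarrow> K' v a b \<or> (v, a, b) \<in> L \<or> (v, b, a) \<in> L" for v a b
  have L: "v \<in> ?X \<and> a \<in> ?X \<and> b \<in> ?X \<and> F k v a \<and> F (\<not> k) v b" if "(v, a, b) \<in> L" for v a b
    using that sym[of "\<not> k" s t] nb unfolding L_def by auto
  have L_fun: "b = c" if "(v, a, b) \<in> L \<or> (v, b, a) \<in> L" "(v, a, c) \<in> L \<or> (v, c, a) \<in> L" for v a b c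
    using that nb(1) unfolding L_def by auto
  have K'1: "K' v b a \<and> (\<exists>k. F k v a \<and> F (\<not> k) v b) \<and> \<not> {v, a} \<subseteq> ?X" if "K' v a b" for v a b
    using that K' unfolding linking_def by blast
  have K'2: "b = c" if "K' v a b" "K' v a c" for v a b c
    using that K' unfolding linking_def by blast
  have Ksym: "K v b a" if "K v a b" for v a b
    using that K'1 unfolding K_def by blast
  have "\<exists>k. F k v a \<and> F (\<not> k) v b" if "K v a b" for v a b
  proof -
    have "F (\<not> k) v a \<and> F (\<not> \<not> k) v b" if "(v, b, a) \<in> L" using L[OF that] by simp
    then have "(v, b, a) \<in> L \<Longrightarrow> ?thesis" by blast
    then show ?thesis using that K'1[of v a b] L[of v a b] unfolding K_def by blast
  qed
  moreover have "b = c" if "K v a b" "K v a c" for v a b c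
  proof -
    have "{v, a} \<subseteq> ?X" if "(v, a, d) \<in> L \<or> (v, d, a) \<in> L" for d
      using that L[of v a d] L[of v d a] by auto
    moreover have "\<not> {v, a} \<subseteq> ?X" if "K' v a d" for d
      using K'1[OF that] by (elim conjE)
    ultimately show ?thesis
      using that K'2[of v a b c] L_fun[of v a b c] unfolding K_def by metis
  qed
  ultimately have lK: "linking F K" unfolding linking_def using Ksym by blast
  let ?R = "(adjoins K)\<^sup>*\<^sup>*"
  have step: "?R {v, a} {v, b}" if "(v, a, b) \<in> L" for v a b
    using that unfolding K_def adjoins_def by blast
  have R_sym: "?R f e" if "?R e f" for e f
    using adjoins_sym that Ksym by metis
  \<comment> \<open>\<open>L\<close> links the edges of the configuration into the trail \<open>s p y s q t p q y t\<close>.\<close>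
  have c1: "?R {s, p} {y, p}" using step[of p s y] by (simp add: L_def insert_commute)
  have c2: "?R {s, p} {y, s}" using c1 R_sym[OF step[of y s p]] by (simp add: L_def insert_commute)
  have c3: "?R {s, p} {s, q}" using c2 step[of s y q] by (simp add: L_def insert_commute)
  have c4: "?R {s, p} {q, t}" using c3 R_sym[OF step[of q t s]] by (simp add: L_def insert_commute)
  have c5: "?R {s, p} {p, t}" using c4 step[of t q p] by (simp add: L_def insert_commute)
  have c6: "?R {s, p} {p, q}" using c5 R_sym[OF step[of p q t]] by (simp add: L_def insert_commute)
  have c7: "?R {s, p} {y, q}" using c6 step[of q p y] by (simp add: L_def insert_commute)
  have c8: "?R {s, p} {y, t}" using c7 R_sym[OF step[of y t q]] by (simp add: L_def insert_commute)
  have c9: "?R {s, p} {s, t}" if "F (\<not> k) s t"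
    using step[of s p t] that by (simp add: L_def insert_commute)
  have all: "?R {s, p} {u, v}" if "F l u v" "u \<in> ?X" "v \<in> ?X" for l u v
  proof -
    have "u \<noteq> v" using that irrefl by metis
    moreover have "F (\<not> k) s t" if "F l s t \<or> F l t s"
    proof -
      have "F l s t" using that sym by blast
      moreover have "\<not> F k s t" using nb(1,3) by auto
      ultimately show ?thesis by (cases "l = k") auto
    qed
    ultimately show ?thesis
      using that c1 c2 c3 c4 c5 c6 c7 c8 c9 by (auto simp: insert_commute)
  qed
  \<comment> \<open>Only \<open>s\<close> and \<open>t\<close> can have neighbours outside. If both
    are joined to \<open>w\<close>, then \<open>sq\<close>, \<open>st\<close> and \<open>sw\<close>
    all have colour \<open>\<not> k\<close>, too many at \<open>s\<close>.\<close>
  have closed: "w \<in> ?X" if "F l u v" "F m u w" "F n v w" "u \<in> ?X" "v \<in> ?X" for l m n u v w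
  proof (rule ccontr)
    assume w: "w \<notin> ?X"
    have inner: "\<not> F m u w" if "u \<in> {y, p, q}" for m u
      using that w nb by (cases "m = k") auto
    have "{u, v} = {s, t}"
      using inner that irrefl by (auto simp: doubleton_eq_iff)
    then have "F l s t" "\<exists>n. F n s w" using that sym by (auto simp: doubleton_eq_iff)
    moreover have "\<not> F k s t" "\<not> F k s w" using nb(1,3) w by auto
    moreover have "F (\<not> k) u v" if "F m u v" "\<not> F k u v" for m u v
      using that by (cases "m = k") auto
    ultimately have "F (\<not> k) s t" "F (\<not> k) s w" by blast+
    then show False using deg2[of "\<not> k" s q t w] nb(1,10) w by auto
  qed
  have "triangle_linked K"
    unfolding triangle_linked_def
  proof (intro allI impI)
    fix l a b x assume T: "tri l a b x"
    note E = T[unfolded tri_def]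
    show "?R {a, b} {a, x} \<or> ?R {a, b} {b, x}"
    proof (cases "{a, b} \<subseteq> ?X \<or> {a, x} \<subseteq> ?X \<or> {b, x} \<subseteq> ?X")
      case True
      then have "a \<in> ?X \<and> b \<in> ?X \<and> x \<in> ?X"
      proof (elim disjE)
        assume "{a, b} \<subseteq> ?X"
        then show ?thesis using closed[of l a b "\<not> l" x "\<not> l"] E by auto
      next
        assume "{a, x} \<subseteq> ?X"
        then show ?thesis using closed[of "\<not> l" a x l b "\<not> l"] E sym by auto
      next
        assume "{b, x} \<subseteq> ?X"
        then show ?thesis using closed[of "\<not> l" b x l a "\<not> l"] E sym by auto
      qed
      then have "?R {s, p} {a, b}" "?R {s, p} {a, x}"
        using all E by blast+
      then show ?thesis using R_sym by (meson rtranclp_trans)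
    next
      case False
      then show ?thesis
        using tri'[OF T] adjoins_mono[of K' K] unfolding K_def by blast
    qed
  qed
  with lK show ?thesis by blast
qed

text \<open>Induction on the number of coloured edges: the edges inside one configuration are
  deleted, and \<open>pent_split\<close> restores them.\<close>

lemma ex_linking:
  assumes "two_coloured F" and "finite {(a, b). \<exists>k. F k a b}"
  shows "\<exists>K. linking F K \<and> two_coloured.triangle_linked F K"
  using assms
proof (induction "card {(a, b). \<exists>k. F k a b}" arbitrary: F rule: less_induct)
  case less
  interpret two_coloured F by fact
  show ?case
  proof (cases "\<exists>k y s p q t. pent k y s p q t")
    case False
    then show ?thesis using pent_free_linking by blast
  next
    case True
    then obtain k y s p q t where X: "pent k y s p q t" by blast
    let ?X = "{y, s, p, q, t}"
    let ?F = "\<lambda>l a b. F l a b \<and> \<not> {a, b} \<subseteq> ?X"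
    interpret F': two_coloured ?F
      by unfold_locales (use sym irrefl disj deg2 in blast)+
    have "(y, s) \<in> {(a, b). \<exists>k. F k a b} - {(a, b). \<exists>k. ?F k a b}"
      using X unfolding pent_def by auto
    then have "{(a, b). \<exists>k. ?F k a b} \<subset> {(a, b). \<exists>k. F k a b}" by blast
    then obtain K' where K': "linking ?F K'" "F'.triangle_linked K'"
      using less.hyps[of ?F] less.prems(2) F'.two_coloured_axioms
      by (metis (no_types, lifting) finite_subset psubset_card_mono psubset_imp_subset)
    show ?thesis
    proof (rule pent_split[OF X K'(1)])
      fix l a b x
      assume "tri l a b x" "\<not> {a, b} \<subseteq> ?X" "\<not> {a, x} \<subseteq> ?X" "\<not> {b, x} \<subseteq> ?X"
      then have "F'.tri l a b x" unfolding F'.tri_def tri_def by blast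
      then show "(adjoins K')\<^sup>*\<^sup>* {a, b} {a, x} \<or> (adjoins K')\<^sup>*\<^sup>* {a, b} {b, x}"
        using K'(2) unfolding F'.triangle_linked_def by blast
    qed
  qed
qed

section \<open>Concatenating alternating trails\<close>

lemma walk_edges_append: "walk_edges (xs @ v # ys) = walk_edges (xs @ [v]) @ walk_edges (v # ys)"
proof (induction xs)
  case (Cons x xs)
  then show ?case by (cases xs) auto
qed simp

lemma walk_edges_rev: "walk_edges (rev us) = rev (walk_edges us)"
proof (induction us rule: walk_edges.induct)
  case (1 u v us)
  have "walk_edges (rev (u # v # us)) = walk_edges (rev us @ v # [u])" by simp
  also have "\<dots> = walk_edges (rev us @ [v]) @ walk_edges [v, u]" by (rule walk_edges_append)
  finally show ?case using 1 by (simp add: insert_commute)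
qed simp_all

text \<open>The vertex next to an end is recorded as well, since it determines the edge with which
  the trail ends.\<close>

definition begins :: "'v list \<Rightarrow> 'v \<Rightarrow> 'v \<Rightarrow> bool" where
  "begins us v a \<longleftrightarrow> (\<exists>zs. us = v # a # zs)"

definition ends :: "'v list \<Rightarrow> 'v \<Rightarrow> 'v \<Rightarrow> bool" where
  "ends us v a \<longleftrightarrow> begins us v a \<or> begins (rev us) v a"

lemma walk_edges_join:
  assumes "begins us v a" "begins vs v b"
  shows "walk_edges (rev us @ tl vs) = rev (walk_edges us) @ walk_edges vs"
proof -
  obtain zs ws where z: "us = v # a # zs" "vs = v # b # ws"
    using assms unfolding begins_def by auto
  then have "rev us @ tl vs = rev (a # zs) @ v # b # ws" by simp
  then have "walk_edges (rev us @ tl vs) = walk_edges (rev (a # zs) @ [v]) @ walk_edges (v # b # ws)"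
    using walk_edges_append by metis
  also have "rev (a # zs) @ [v] = rev us" using z by simp
  finally show ?thesis using z by (simp only: walk_edges_rev)
qed

locale sym_difference =
  fixes E A\<^sub>1 A\<^sub>2 :: "'v set set"
  assumes finE: "finite E" and A1: "A\<^sub>1 \<subseteq> E" and A2: "A\<^sub>2 \<subseteq> E"
    and edge: "e \<in> E \<Longrightarrow> \<exists>u v. e = {u, v}"
begin

abbreviation R where "R \<equiv> A\<^sub>1 - A\<^sub>2"
abbreviation B where "B \<equiv> A\<^sub>2 - A\<^sub>1"

definition alt_trail :: "'v list \<Rightarrow> bool" where
  "alt_trail us \<longleftrightarrow> is_trail E us \<and> alternating A\<^sub>1 A\<^sub>2 us"

definition opposite :: "'v set \<Rightarrow> 'v set \<Rightarrow> bool" where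
  "opposite e f \<longleftrightarrow> e \<in> R \<and> f \<in> B \<or> e \<in> B \<and> f \<in> R"

text \<open>The edge sets thus partition \<open>R \<union> B\<close>; nonemptiness and the converse
  inclusion are contained in \<open>alt_trail\<close>.\<close>

definition trails :: "'v list set \<Rightarrow> bool" where
  "trails S \<longleftrightarrow> finite S \<and> (\<forall>us\<in>S. alt_trail us) \<and> R \<union> B \<subseteq> (\<Union>us\<in>S. set (walk_edges us)) \<and>
     (\<forall>us\<in>S. \<forall>vs\<in>S. us \<noteq> vs \<longrightarrow> set (walk_edges us) \<inter> set (walk_edges vs) = {})"

definition together :: "'v list set \<Rightarrow> 'v set \<Rightarrow> 'v set \<Rightarrow> bool" where
  "together S e f \<longleftrightarrow> (\<exists>us\<in>S. e \<in> set (walk_edges us) \<and> f \<in> set (walk_edges us))"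

lemma opposite_sym: "opposite e f \<longleftrightarrow> opposite f e"
  unfolding opposite_def by blast

lemma alt_trail_iff:
  "alt_trail us \<longleftrightarrow> length us \<ge> 2 \<and> distinct (walk_edges us) \<and> set (walk_edges us) \<subseteq> R \<union> B \<and>
     successively opposite (walk_edges us)"
  unfolding alt_trail_def is_trail_def alternating_def opposite_def[abs_def]
  using A1 A2 by auto

lemma alt_trail_rev: "alt_trail (rev us) \<longleftrightarrow> alt_trail us"
  unfolding alt_trail_iff walk_edges_rev by (auto simp: opposite_sym)

lemma alt_trail_join:
  assumes "alt_trail us" "alt_trail vs" "begins us v a" "begins vs v b" "opposite {v, a} {v, b}"
    and "set (walk_edges us) \<inter> set (walk_edges vs) = {}"
  shows "alt_trail (rev us @ tl vs)"
proof -
  obtain zs ws where z: "us = v # a # zs" "vs = v # b # ws"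
    using assms unfolding begins_def by auto
  have "alt_trail (rev us)" using assms alt_trail_rev by simp
  then have "successively opposite (rev (walk_edges us))" "successively opposite (walk_edges vs)"
    using assms(2) unfolding alt_trail_iff walk_edges_rev by blast+
  moreover have "last (rev (walk_edges us)) = {v, a}" "hd (walk_edges vs) = {v, b}"
    using z by (simp_all add: last_rev)
  ultimately have "successively opposite (rev (walk_edges us) @ walk_edges vs)"
    unfolding successively_append_iff using assms(5) by simp
  then show ?thesis
    using assms(1,2,6) z unfolding alt_trail_iff walk_edges_join[OF assms(3,4)] by auto
qed

text \<open>Concatenation at \<open>v\<close>. The smaller cardinality makes repeated merging stop;
  the survival of all other ends allows several links to be realised in turn.\<close>

lemma trails_merge:
  assumes S: "trails S" "us \<in> S" "vs \<in> S" "us \<noteq> vs" and e: "ends us v a" "ends vs v b"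
    and opp: "opposite {v, a} {v, b}"
  shows "\<exists>S'. trails S' \<and> card S' < card S \<and> (\<forall>e f. together S e f \<longrightarrow> together S' e f) \<and>
    together S' {v, a} {v, b} \<and>
    (\<forall>ws\<in>S. \<forall>w c. ends ws w c \<longrightarrow> (w, c) \<noteq> (v, a) \<longrightarrow> (w, c) \<noteq> (v, b) \<longrightarrow> (\<exists>ws\<in>S'. ends ws w c))"
proof -
  obtain us' where us': "us' \<in> {us, rev us}" "begins us' v a" using e unfolding ends_def by auto
  obtain vs' where vs': "vs' \<in> {vs, rev vs}" "begins vs' v b" using e unfolding ends_def by auto
  have we: "set (walk_edges us') = set (walk_edges us)" "set (walk_edges vs') = set (walk_edges vs)"
    using us' vs' by (auto simp: walk_edges_rev)
  define ns where "ns = rev us' @ tl vs'"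
  define S' where "S' = insert ns (S - {us, vs})"
  have alt: "alt_trail us'" "alt_trail vs'"
    using S us' vs' alt_trail_rev unfolding trails_def by auto
  have disS: "set (walk_edges xs) \<inter> set (walk_edges ys) = {}" if "xs \<in> S" "ys \<in> S" "xs \<noteq> ys" for xs ys
    using S(1) that unfolding trails_def by simp
  note dis = disS[OF S(2-4)]
  have ns: "alt_trail ns"
    unfolding ns_def using alt us'(2) vs'(2) opp dis we by (intro alt_trail_join) auto
  have wns: "set (walk_edges ns) = set (walk_edges us) \<union> set (walk_edges vs)"
    unfolding ns_def walk_edges_join[OF us'(2) vs'(2)] using we by simp
  show ?thesis
  proof (intro exI[of _ S'] conjI allI ballI impI)
    have disN: "set (walk_edges ns) \<inter> set (walk_edges ws) = {}" if "ws \<in> S - {us, vs}" for ws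
      using that disS[of us ws] disS[of vs ws] S(2,3) wns by auto
    show "trails S'"
      unfolding trails_def
    proof (intro conjI ballI impI)
      show "finite S'" using S(1) unfolding trails_def S'_def by simp
      show "alt_trail xs" if "xs \<in> S'" for xs
        using that ns S(1) unfolding trails_def S'_def by auto
      have "R \<union> B \<subseteq> (\<Union>us\<in>S. set (walk_edges us))" using S(1) unfolding trails_def by simp
      also have "\<dots> \<subseteq> (\<Union>us\<in>S'. set (walk_edges us))" unfolding S'_def using wns by auto
      finally show "R \<union> B \<subseteq> (\<Union>us\<in>S'. set (walk_edges us))" .
      show "set (walk_edges xs) \<inter> set (walk_edges ys) = {}" if "xs \<in> S'" "ys \<in> S'" "xs \<noteq> ys" for xs ys
        using that disN[of xs] disN[of ys] disS[of xs ys] unfolding S'_def by (auto simp: Int_commute)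
    qed
    have "finite S" using S unfolding trails_def by simp
    then have "card (S - {us, vs}) = card S - 2" "card S \<ge> 2"
      using S(2-4) card_Diff_subset[of "{us, vs}" S] card_mono[of S "{us, vs}"] by auto
    moreover have "card S' \<le> Suc (card (S - {us, vs}))"
      unfolding S'_def by (simp add: card_insert_le_m1 \<open>finite S\<close> card_insert_if)
    ultimately show "card S' < card S" by simp
    show "together S' e f" if "together S e f" for e f
      using that wns unfolding together_def S'_def by blast
    have "{v, a} \<in> set (walk_edges us)" "{v, b} \<in> set (walk_edges vs)"
      using us'(2) vs'(2) we unfolding begins_def by auto
    then show "together S' {v, a} {v, b}" using wns unfolding together_def S'_def by blast
    show "\<exists>ws\<in>S'. ends ws w c" if "ws \<in> S" "ends ws w c" "(w, c) \<noteq> (v, a)" "(w, c) \<noteq> (v, b)" for ws w c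
    proof -
      \<comment> \<open>An end of \<open>us\<close> or \<open>vs\<close> other than the consumed one
        is the far end, which becomes an end of \<open>ns\<close>.\<close>
      consider "ws = us" | "ws = vs" | "ws \<in> S'" using \<open>ws \<in> S\<close> S'_def by auto
      then show ?thesis
      proof cases
        case 1
        then have "begins us' w c \<or> begins (rev us') w c"
          using that(2) us'(1) unfolding ends_def by auto
        then have "begins (rev us') w c" using us'(2) that(3) unfolding begins_def by auto
        then have "ends ns w c" unfolding begins_def ends_def ns_def by auto
        then show ?thesis unfolding S'_def by blast
      next
        case 2
        then have "begins vs' w c \<or> begins (rev vs') w c"
          using that(2) vs'(1) unfolding ends_def by auto
        then have "begins (rev vs') w c" using vs'(2) that(4) unfolding begins_def by auto
        moreover have "rev ns = rev vs' @ tl us'"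
          using us'(2) vs'(2) unfolding ns_def begins_def by auto
        ultimately have "ends ns w c" unfolding begins_def ends_def by auto
        then show ?thesis unfolding S'_def by blast
      next
        case 3
        then show ?thesis using that by blast
      qed
    qed
  qed
qed

lemma trails_singletons:
  "\<exists>S. trails S \<and> (\<forall>v a. {v, a} \<in> R \<union> B \<longrightarrow> (\<exists>us\<in>S. ends us v a))"
proof -
  define g :: "'v set \<Rightarrow> 'v list" where "g e = (SOME us. \<exists>u v. us = [u, v] \<and> e = {u, v})" for e
  have g: "\<exists>u v. g e = [u, v] \<and> e = {u, v}" if "e \<in> R \<union> B" for e
    unfolding g_def by (rule someI_ex) (use that edge A1 A2 in blast)
  have w: "walk_edges (g e) = [e]" "length (g e) = 2" if "e \<in> R \<union> B" for e
  proof -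
    obtain u v where "g e = [u, v]" "e = {u, v}" using g[OF \<open>e \<in> R \<union> B\<close>] by blast
    then show "walk_edges (g e) = [e]" "length (g e) = 2" by simp_all
  qed
  let ?S = "g ` (R \<union> B)"
  have "trails ?S"
    unfolding trails_def alt_trail_iff using w finE A1 A2
    by (auto intro: finite_subset[of _ E])
  moreover have "\<exists>us\<in>?S. ends us v a" if "{v, a} \<in> R \<union> B" for v a
  proof -
    obtain x y where xy: "g {v, a} = [x, y]" "{v, a} = {x, y}" using g[OF \<open>{v, a} \<in> R \<union> B\<close>] by blast
    have "ends [x, y] v a"
      using xy(2) unfolding ends_def begins_def by (auto simp: doubleton_eq_iff)
    then have "ends (g {v, a}) v a" using xy(1) by simp
    then show ?thesis using that by blast
  qed
  ultimately show ?thesis by blast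
qed

text \<open>Starting from single edges, links are realised one at a time. Injectivity of
  \<open>L\<close> in both edges keeps the two ends of a link free until its turn.\<close>

lemma trails_along:
  assumes "finite L"
    and "\<And>v a b. (v, a, b) \<in> L \<Longrightarrow> {v, a} \<in> R \<and> {v, b} \<in> B"
    and "\<And>v a b c. (v, a, b) \<in> L \<Longrightarrow> (v, a, c) \<in> L \<Longrightarrow> b = c"
    and "\<And>v a b c. (v, a, b) \<in> L \<Longrightarrow> (v, c, b) \<in> L \<Longrightarrow> a = c"
  shows "\<exists>S. trails S \<and> (\<forall>v a b. (v, a, b) \<in> L \<longrightarrow> together S {v, a} {v, b}) \<and>
    (\<forall>v a. {v, a} \<in> R \<union> B \<longrightarrow> (\<forall>b. (v, a, b) \<notin> L \<and> (v, b, a) \<notin> L) \<longrightarrow> (\<exists>us\<in>S. ends us v a))"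
  using assms
proof (induction L rule: finite_induct)
  case empty
  then show ?case using trails_singletons by simp
next
  case (insert l L)
  obtain v a b where l: "l = (v, a, b)" by (cases l)
  have "\<exists>S. trails S \<and> (\<forall>v a b. (v, a, b) \<in> L \<longrightarrow> together S {v, a} {v, b}) \<and>
    (\<forall>v a. {v, a} \<in> R \<union> B \<longrightarrow> (\<forall>b. (v, a, b) \<notin> L \<and> (v, b, a) \<notin> L) \<longrightarrow> (\<exists>us\<in>S. ends us v a))"
    by (rule insert.IH; use insert.prems in blast)
  then obtain S where S: "trails S" "\<And>v a b. (v, a, b) \<in> L \<Longrightarrow> together S {v, a} {v, b}"
    "\<And>v a. {v, a} \<in> R \<union> B \<Longrightarrow> (\<forall>b. (v, a, b) \<notin> L \<and> (v, b, a) \<notin> L) \<Longrightarrow> \<exists>us\<in>S. ends us v a"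
    by metis
  have ab: "{v, a} \<in> R" "{v, b} \<in> B" using insert.prems(1)[of v a b] l by auto
  have fa: "(v, a, c) \<notin> L" "(v, c, b) \<notin> L" for c
    using insert.prems(2)[of v a b c] insert.prems(3)[of v a b c] insert.hyps(2) l by auto
  have fb: "(v, c, a) \<notin> L" "(v, b, c) \<notin> L" for c
    using insert.prems(1)[of v c a] insert.prems(1)[of v b c] ab by auto
  obtain us where us: "us \<in> S" "ends us v a" using S(3)[of v a] ab fa fb by blast
  obtain vs where vs: "vs \<in> S" "ends vs v b" using S(3)[of v b] ab fa fb by blast
  show ?case
  proof (cases "us = vs")
    \<comment> \<open>Two ends of one trail need no merging, as their edges are together
      already.\<close>
    case True
    have mem: "{v, a} \<in> set (walk_edges us)" if "ends us v a" for v a us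
    proof -
      have "{v, a} \<in> set (walk_edges us) \<or> {v, a} \<in> set (walk_edges (rev us))"
        using that unfolding ends_def begins_def by (metis list.set_intros(1) walk_edges.simps(1))
      then show ?thesis by (simp add: walk_edges_rev)
    qed
    have "together S {v, a} {v, b}"
      unfolding together_def using us(1) mem[OF us(2)] mem[OF vs(2)] True by auto
    then show ?thesis using S l by (intro exI[of _ S]) auto
  next
    case False
    have "opposite {v, a} {v, b}" using ab unfolding opposite_def by blast
    from trails_merge[OF S(1) us(1) vs(1) False us(2) vs(2) this]
    obtain S' where S': "trails S'" "\<forall>e f. together S e f \<longrightarrow> together S' e f"
      "together S' {v, a} {v, b}"
      "\<forall>ws\<in>S. \<forall>w c. ends ws w c \<longrightarrow> (w, c) \<noteq> (v, a) \<longrightarrow> (w, c) \<noteq> (v, b) \<longrightarrow> (\<exists>ws\<in>S'. ends ws w c)"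
      by (elim exE conjE) (rule that; assumption)
    have "\<exists>us\<in>S'. ends us w c"
      if h: "{w, c} \<in> R \<union> B" "\<forall>d. (w, c, d) \<notin> insert l L \<and> (w, d, c) \<notin> insert l L" for w c
    proof -
      have "(w, c) \<noteq> (v, a)" "(w, c) \<noteq> (v, b)" using h(2) l by auto
      moreover obtain ws where "ws \<in> S" "ends ws w c" using S(3)[of w c] h by auto
      ultimately show ?thesis using S'(4) by simp
    qed
    then show ?thesis using S'(1-3) S(2) l by (intro exI[of _ S']) auto
  qed
qed

end

section \<open>Degrees\<close>

text \<open>The contribution of one edge to \<open>deg\<close>, taken in the integers so that it can
  carry a sign.\<close>

definition ecount :: "'v set \<Rightarrow> 'v \<Rightarrow> int" where
  "ecount e v = (if v \<in> e then 1 else 0) + (if e = {v} then 1 else 0)"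

lemma ecount_doubleton: "ecount {u, w} v = (if u = v then 1 else 0) + (if w = v then 1 else 0)"
  unfolding ecount_def by auto

lemma deg_eq_sum: "finite F \<Longrightarrow> int (deg F v) = (\<Sum>e\<in>F. ecount e v)"
proof -
  assume "finite F"
  then have "int (card {e \<in> F. Q e}) = (\<Sum>e\<in>F. if Q e then 1 else 0)" for Q
    by (simp add: sum.inter_filter[symmetric])
  then show ?thesis unfolding deg_def ecount_def by (simp only: sum.distrib of_nat_add)
qed

context sym_difference
begin

definition sgn_edge :: "'v set \<Rightarrow> int" where
  "sgn_edge e = (if e \<in> B then 1 else - 1)"

text \<open>This is the change of \<open>deg A\<^sub>1 v\<close> when the trail is switched, and
  minus the change of \<open>deg A\<^sub>2 v\<close>.\<close>

definition net :: "'v list \<Rightarrow> 'v \<Rightarrow> int" where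
  "net us v = (\<Sum>e\<in>set (walk_edges us). sgn_edge e * ecount e v)"

lemma finite_R_B: "finite R" "finite B"
  using finE A1 A2 finite_subset by blast+

lemma opposite_sgn: "opposite e f \<Longrightarrow> sgn_edge f = - sgn_edge e"
  unfolding opposite_def sgn_edge_def by auto

lemma sum_sgn:
  assumes "P \<subseteq> R \<union> B"
  shows "(\<Sum>e\<in>P. sgn_edge e * ecount e v) = (\<Sum>e\<in>P \<inter> B. ecount e v) - (\<Sum>e\<in>P \<inter> R. ecount e v)"
proof -
  have fin: "finite P" using assms finite_R_B finite_subset by blast
  have "P = (P \<inter> B) \<union> (P \<inter> R)" using assms by blast
  then have "(\<Sum>e\<in>P. sgn_edge e * ecount e v) = (\<Sum>e\<in>(P \<inter> B) \<union> (P \<inter> R). sgn_edge e * ecount e v)"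
    by simp
  also have "\<dots> = (\<Sum>e\<in>P \<inter> B. sgn_edge e * ecount e v) + (\<Sum>e\<in>P \<inter> R. sgn_edge e * ecount e v)"
    by (rule sum.union_disjoint) (use fin in auto)
  also have "(\<Sum>e\<in>P \<inter> B. sgn_edge e * ecount e v) = (\<Sum>e\<in>P \<inter> B. ecount e v)"
    by (rule sum.cong) (auto simp: sgn_edge_def)
  also have "(\<Sum>e\<in>P \<inter> R. sgn_edge e * ecount e v) = - (\<Sum>e\<in>P \<inter> R. ecount e v)"
    unfolding sum_negf[symmetric] by (rule sum.cong) (auto simp: sgn_edge_def)
  finally show ?thesis by simp
qed

text \<open>Consecutive edges have opposite signs and cancel at their common vertex, so only the two
  ends contribute.\<close>

lemma sum_list_net:
  "length us \<ge> 2 \<Longrightarrow> successively opposite (walk_edges us) \<Longrightarrow>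
   (\<Sum>e\<leftarrow>walk_edges us. sgn_edge e * ecount e v) =
     (if hd us = v then sgn_edge (hd (walk_edges us)) else 0) +
     (if last us = v then sgn_edge (last (walk_edges us)) else 0)"
proof (induction us rule: walk_edges.induct)
  case (1 u w us)
  show ?case
  proof (cases us)
    case Nil
    then show ?thesis by (simp add: ecount_doubleton algebra_simps)
  next
    case (Cons x xs)
    have "sgn_edge {w, x} = - sgn_edge {u, w}" using 1(3) Cons opposite_sgn by simp
    then show ?thesis using 1 Cons by (auto simp: ecount_doubleton algebra_simps)
  qed
qed simp_all

lemma net_eq:
  assumes "alt_trail us"
  shows "net us v = (if hd us = v then sgn_edge (hd (walk_edges us)) else 0) +
     (if last us = v then sgn_edge (last (walk_edges us)) else 0)"
  using assms sum_list_net[of us v] sum_list_distinct_conv_sum_set[of "walk_edges us"]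
  unfolding alt_trail_iff net_def by metis

text \<open>By \<open>net_eq\<close> a nonzero value comes from ends at \<open>v\<close> that do not
  cancel, so their colour is given by the sign.\<close>

lemma net_end:
  assumes "alt_trail us" "net us v \<noteq> 0"
  shows "\<exists>a. ends us v a \<and> {v, a} \<in> (if net us v > 0 then B else R)"
proof -
  obtain u w zs where us: "us = u # w # zs"
    using assms(1) unfolding alt_trail_iff by (cases us; cases "tl us") auto
  have "rev us \<noteq> []" "tl (rev us) \<noteq> []"
    unfolding us by (cases zs rule: rev_cases; simp)+
  then obtain x y ws where rus: "rev us = x # y # ws"
    by (metis list.exhaust_sel)
  have h: "hd us = u" "hd (walk_edges us) = {u, w}" using us by auto
  have "last us = hd (rev us)" "last (walk_edges us) = hd (walk_edges (rev us))"
    by (simp_all add: hd_rev walk_edges_rev)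
  then have l: "last us = x" "last (walk_edges us) = {x, y}" unfolding rus by simp_all
  have "walk_edges us \<noteq> []" using us by simp
  then have "hd (walk_edges us) \<in> R \<union> B" "last (walk_edges us) \<in> R \<union> B"
    using assms(1) hd_in_set last_in_set unfolding alt_trail_iff by blast+
  then have m: "{u, w} \<in> R \<union> B" "{x, y} \<in> R \<union> B" using h l by auto
  have e: "ends us u w" "ends us x y" unfolding ends_def begins_def using us rus by auto
  show ?thesis
    using net_eq[OF assms(1), of v] assms(2) e m unfolding h l sgn_edge_def
    by (auto split: if_splits)
qed

section \<open>Unmergeable trails and the degree bound\<close>

lemma ex_unmergeable_trails:
  assumes "trails S"
  shows "\<exists>S'. trails S' \<and> (\<forall>e f. together S e f \<longrightarrow> together S' e f) \<and>
    (\<forall>us\<in>S'. \<forall>vs\<in>S'. \<forall>v a b. us \<noteq> vs \<longrightarrow> ends us v a \<longrightarrow> ends vs v b \<longrightarrow> \<not> opposite {v, a} {v, b})"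
  using assms
proof (induction "card S" arbitrary: S rule: less_induct)
  case less
  show ?case
  proof (cases "\<exists>us\<in>S. \<exists>vs\<in>S. \<exists>v a b. us \<noteq> vs \<and> ends us v a \<and> ends vs v b \<and> opposite {v, a} {v, b}")
    case True
    then obtain us vs v a b where "us \<in> S" "vs \<in> S" "us \<noteq> vs" "ends us v a" "ends vs v b"
      "opposite {v, a} {v, b}" by blast
    from trails_merge[OF less.prems this]
    obtain T where T: "trails T" "card T < card S" "\<forall>e f. together S e f \<longrightarrow> together T e f"
      by (elim exE conjE) (rule that; assumption)
    then show ?thesis using less.hyps[OF T(2,1)] by (elim exE conjE) (rule exI, intro conjI; blast)
  next
    case False
    then show ?thesis using less.prems by blast
  qed
qed

lemma deg_sym_diff:
  assumes "P \<subseteq> R \<union> B"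
  shows "int (deg (sym_diff A\<^sub>1 P) v) = int (deg A\<^sub>1 v) + (\<Sum>e\<in>P. sgn_edge e * ecount e v)"
    and "int (deg (sym_diff A\<^sub>2 P) v) = int (deg A\<^sub>2 v) - (\<Sum>e\<in>P. sgn_edge e * ecount e v)"
proof -
  have fin: "finite P" "finite A\<^sub>1" "finite A\<^sub>2"
    using assms finite_R_B finite_subset finE A1 A2 by blast+
  have "sym_diff A\<^sub>1 P = (A\<^sub>1 - P \<inter> R) \<union> (P \<inter> B)" "(A\<^sub>1 - P \<inter> R) \<inter> (P \<inter> B) = {}"
    "sym_diff A\<^sub>2 P = (A\<^sub>2 - P \<inter> B) \<union> (P \<inter> R)" "(A\<^sub>2 - P \<inter> B) \<inter> (P \<inter> R) = {}"
    "P \<inter> R \<subseteq> A\<^sub>1" "P \<inter> B \<subseteq> A\<^sub>2"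
    using assms by auto
  then show "int (deg (sym_diff A\<^sub>1 P) v) = int (deg A\<^sub>1 v) + (\<Sum>e\<in>P. sgn_edge e * ecount e v)"
    and "int (deg (sym_diff A\<^sub>2 P) v) = int (deg A\<^sub>2 v) - (\<Sum>e\<in>P. sgn_edge e * ecount e v)"
    using fin unfolding sum_sgn[OF assms]
    by (simp_all add: deg_eq_sum sum.union_disjoint sum_diff)
qed

text \<open>Switching all of \<open>R \<union> B\<close> turns \<open>A\<^sub>1\<close> into
  \<open>A\<^sub>2\<close>.\<close>

lemma sum_net:
  assumes "trails S"
  shows "(\<Sum>us\<in>S. net us v) = int (deg A\<^sub>2 v) - int (deg A\<^sub>1 v)"
proof -
  have U: "(\<Union>us\<in>S. set (walk_edges us)) = R \<union> B"
    using assms unfolding trails_def alt_trail_iff by blast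
  have "(\<Sum>us\<in>S. net us v) = (\<Sum>e\<in>R \<union> B. sgn_edge e * ecount e v)"
    unfolding net_def U[symmetric]
    by (rule sum.UNION_disjoint[symmetric]) (use assms in \<open>auto simp: trails_def\<close>)
  also have "\<dots> = int (deg (sym_diff A\<^sub>1 (R \<union> B)) v) - int (deg A\<^sub>1 v)"
    by (simp add: deg_sym_diff(1)[OF order_refl])
  also have "sym_diff A\<^sub>1 (R \<union> B) = A\<^sub>2" by blast
  finally show ?thesis .
qed

text \<open>No two trails have ends of opposite colours at \<open>v\<close>, so no other trail
  counts against \<open>us\<close>. Hence \<open>net us v\<close> lies between 0 and the total
  excess, and switching keeps each degree between the two old ones.\<close>

lemma deg_unmergeable:
  assumes S: "trails S" and us: "us \<in> S"
    and un: "\<forall>us\<in>S. \<forall>vs\<in>S. \<forall>v a b. us \<noteq> vs \<longrightarrow> ends us v a \<longrightarrow> ends vs v b \<longrightarrow> \<not> opposite {v, a} {v, b}"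
    and A: "A \<in> {A\<^sub>1, A\<^sub>2}"
  shows "deg (sym_diff A (set (walk_edges us))) v \<le> max (deg A\<^sub>1 v) (deg A\<^sub>2 v)"
proof -
  let ?n = "net us v"
  have alt: "alt_trail vs" if "vs \<in> S" for vs using S that unfolding trails_def by blast
  have fin: "finite S" using S unfolding trails_def by blast
  have same: "net vs v * ?n \<ge> 0" if vs: "vs \<in> S" "vs \<noteq> us" for vs
  proof (rule ccontr)
    assume neg: "\<not> net vs v * ?n \<ge> 0"
    then have nz: "net vs v \<noteq> 0" "?n \<noteq> 0" by auto
    have sg: "(net vs v > 0) \<noteq> (?n > 0)" using neg by (auto simp: mult_less_0_iff not_le)
    obtain a where a: "ends us v a" "{v, a} \<in> (if ?n > 0 then B else R)"
      using net_end[OF alt[OF us] nz(2)] by (elim exE conjE)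
    obtain b where b: "ends vs v b" "{v, b} \<in> (if net vs v > 0 then B else R)"
      using net_end[OF alt[OF vs(1)] nz(1)] by (elim exE conjE)
    have "opposite {v, a} {v, b}"
      using sg a(2) b(2) unfolding opposite_def by (auto split: if_splits)
    then show False using un us vs a(1) b(1) by metis
  qed
  have tot: "?n + (\<Sum>vs\<in>S - {us}. net vs v) = int (deg A\<^sub>2 v) - int (deg A\<^sub>1 v)"
    using sum_net[OF S, of v] sum.remove[OF fin us, of "\<lambda>us. net us v"] by simp
  have "?n > 0 \<Longrightarrow> (\<Sum>vs\<in>S - {us}. net vs v) \<ge> 0"
    by (rule sum_nonneg) (use same in \<open>auto simp: zero_le_mult_iff\<close>)
  moreover have "?n < 0 \<Longrightarrow> (\<Sum>vs\<in>S - {us}. net vs v) \<le> 0"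
    by (rule sum_nonpos) (use same in \<open>auto simp: zero_le_mult_iff\<close>)
  moreover have "set (walk_edges us) \<subseteq> R \<union> B" using alt[OF us] unfolding alt_trail_iff by blast
  note deg_sym_diff[OF this, of v, folded net_def]
  ultimately show ?thesis using A tot by (cases "?n > 0"; cases "?n < 0"; auto)
qed

end

section \<open>Two matchings with common edges\<close>

lemma deg_le_2:
  assumes "finite A" "deg A v \<le> 2" "{v, a} \<in> A" "{v, b} \<in> A" "{v, c} \<in> A"
  shows "a = b \<or> a = c \<or> b = c"
proof (rule ccontr)
  assume "\<not> ?thesis"
  then have "card {{v, a}, {v, b}, {v, c}} = 3" by (auto simp: doubleton_eq_iff)
  moreover have "card {{v, a}, {v, b}, {v, c}} \<le> card {e \<in> A. v \<in> e}"
    by (rule card_mono) (use assms in auto)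
  ultimately show False using assms(2) unfolding deg_def by simp
qed

locale two_matchings = sym_difference E A\<^sub>1 A\<^sub>2 for E A\<^sub>1 A\<^sub>2 :: "'v set set" +
  assumes deg1: "deg A\<^sub>1 v \<le> 2" and deg2: "deg A\<^sub>2 v \<le> 2"
begin

definition M :: "bool \<Rightarrow> 'v set set" where
  "M k = (if k then A\<^sub>1 else A\<^sub>2)"

text \<open>Loops are left out because no triangle contains one; they reappear as edges of
  trails.\<close>

definition adj :: "bool \<Rightarrow> 'v \<Rightarrow> 'v \<Rightarrow> bool" where
  "adj k a b \<longleftrightarrow> a \<noteq> b \<and> {a, b} \<in> M k \<and> {a, b} \<notin> M (\<not> k)"

definition common :: "'v \<Rightarrow> 'v \<Rightarrow> bool" where
  "common a b \<longleftrightarrow> {a, b} \<in> A\<^sub>1 \<inter> A\<^sub>2"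

lemma M_deg: "{v, a} \<in> M k \<Longrightarrow> {v, b} \<in> M k \<Longrightarrow> {v, c} \<in> M k \<Longrightarrow> a = b \<or> a = c \<or> b = c"
  using deg_le_2[of "M k" v a b c] deg1[of v] deg2[of v] finE A1 A2 finite_subset
  unfolding M_def by (auto split: if_splits)

lemma common_M: "common a b \<Longrightarrow> {a, b} \<in> M k"
  unfolding common_def M_def by auto

lemma common_sym: "common a b \<Longrightarrow> common b a"
  unfolding common_def by (simp add: insert_commute)

lemma common_not_adj: "common a b \<Longrightarrow> \<not> adj k a b"
  unfolding common_def adj_def M_def by auto

lemma adj_M: "adj k a b \<Longrightarrow> {a, b} \<in> M k"
  unfolding adj_def by blast

lemma two_coloured_adj: "two_coloured adj"
proof
  show "adj k a b \<Longrightarrow> adj k b a" for k a b unfolding adj_def by (auto simp: insert_commute)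
  show "\<not> adj k a a" for k a unfolding adj_def by simp
  show "adj k a b \<Longrightarrow> \<not> adj (\<not> k) a b" for k a b unfolding adj_def by simp
  show "adj k v a \<Longrightarrow> adj k v b \<Longrightarrow> adj k v c \<Longrightarrow> a = b \<or> a = c \<or> b = c" for k v a b c
    using M_deg adj_M by metis
qed

sublocale adj: two_coloured adj
  by (rule two_coloured_adj)

text \<open>Next to a common edge a vertex has at most one edge of each colour, so there the links are
  forced; the remaining triangles live on the vertices without common edges.\<close>

lemma ex_adj_linking:
  "\<exists>K. linking adj K \<and> adj.triangle_linked K \<and>
    (\<forall>k x a b. adj k x a \<longrightarrow> adj (\<not> k) x b \<longrightarrow> common a b \<longrightarrow> K x a b)"
proof -
  define touched where "touched a \<longleftrightarrow> (\<exists>b. common a b)" for a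
  let ?F = "\<lambda>k a b. adj k a b \<and> \<not> touched a \<and> \<not> touched b"
  interpret F: two_coloured ?F
    by unfold_locales (use adj.sym adj.irrefl adj.disj adj.deg2 in blast)+
  have "finite {(a, b). \<exists>k. adj k a b}"
  proof (rule finite_subset)
    have "finite (\<Union>E)" using finE edge by fastforce
    then show "finite (\<Union>E \<times> \<Union>E)" by simp
    show "{(a, b). \<exists>k. adj k a b} \<subseteq> \<Union>E \<times> \<Union>E"
      using A1 A2 unfolding adj_def M_def by (auto split: if_splits)
  qed
  then have "finite {(a, b). \<exists>k. ?F k a b}" by (rule rev_finite_subset) blast
  then obtain K' where K': "linking ?F K'" "F.triangle_linked K'"
    using ex_linking[OF F.two_coloured_axioms] by blast
  \<comment> \<open>The disjunct \<open>common a b\<close> serves triangles with one common edge,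
    linked at the vertex opposite to it.\<close>
  define K where "K v a b \<longleftrightarrow> K' v a b \<or>
    (\<exists>k. adj k v a \<and> adj (\<not> k) v b \<and> (touched v \<or> common a b))" for v a b
  have K'1: "K' v b a" "\<exists>k. ?F k v a \<and> ?F (\<not> k) v b" if "K' v a b" for v a b
    using that K'(1) unfolding linking_def by blast+
  have K'2: "b = c" if "K' v a b" "K' v a c" for v a b c
    using that K'(1) unfolding linking_def by blast
  have K'3: "\<not> touched v" "\<not> touched a" if "K' v a b" for v a b
    using K'1(2)[OF that] by blast+
  \<comment> \<open>A common edge belongs to both matchings; at a touched \<open>v\<close>, and
    otherwise at \<open>a\<close>, the common edges leave room for only one choice.\<close>
  have uniq: "b = c" if k: "adj k v a" "adj (\<not> k) v b" "adj (\<not> k) v c"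
    and h: "touched v \<or> common a b" "touched v \<or> common a c" for k v a b c
  proof (cases "touched v")
    case True
    then obtain w where w: "common v w" unfolding touched_def by blast
    then have "w \<noteq> b" "w \<noteq> c" using k common_not_adj by blast+
    then show ?thesis using M_deg[of v w "\<not> k" b c] common_M[OF w] adj_M[OF k(2)] adj_M[OF k(3)] by blast
  next
    case False
    then have ab: "common a b" "common a c" using h by auto
    have "v \<noteq> b" "v \<noteq> c" using k adj.irrefl by metis+
    then show ?thesis
      using M_deg[of a v k b c] common_M[OF ab(1)] common_M[OF ab(2)] adj_M[OF adj.sym[OF k(1)]] by blast
  qed
  \<comment> \<open>A forced link at an untouched \<open>v\<close> involves only touched neighbours,
    so it never meets a link of \<open>K'\<close>.\<close>
  have one: "b = c" if K: "K' v a b" "K v a c" for v a b c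
  proof -
    have "\<not> touched v" "\<not> touched a" using K'3[OF K(1)] .
    then have "K' v a c" using K(2) unfolding K_def touched_def by blast
    then show ?thesis using K'2 K(1) by blast
  qed
  have "linking adj K"
    unfolding linking_def
  proof (intro conjI allI impI)
    fix v a b assume K: "K v a b"
    show "\<exists>k. adj k v a \<and> adj (\<not> k) v b" using K K'1(2)[of v a b] unfolding K_def by blast
    show "K v b a"
    proof (cases "K' v a b")
      case True
      then show ?thesis using K'1(1) unfolding K_def by blast
    next
      case False
      then obtain k where "adj k v a" "adj (\<not> k) v b" "touched v \<or> common a b"
        using K unfolding K_def by blast
      then have "adj (\<not> k) v b \<and> adj (\<not> \<not> k) v a \<and> (touched v \<or> common b a)"
        using common_sym by auto
      then show ?thesis unfolding K_def by blast
    qed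
  next
    fix v a b c assume K: "K v a b" "K v a c"
    show "b = c"
    proof (cases "K' v a b \<or> K' v a c")
      case True
      then show ?thesis using one K by blast
    next
      case False
      then obtain k l where kl: "adj k v a" "adj (\<not> k) v b" "touched v \<or> common a b"
        "adj l v a" "adj (\<not> l) v c" "touched v \<or> common a c"
        using K unfolding K_def by blast
      then have "k = l" using adj.colour_unique by blast
      then show ?thesis using uniq kl by blast
    qed
  qed
  moreover have "adj.triangle_linked K"
    unfolding adj.triangle_linked_def
  proof (intro allI impI)
    fix k a b x assume T: "adj.tri k a b x"
    note e = T[unfolded adj.tri_def]
    show "(adjoins K)\<^sup>*\<^sup>* {a, b} {a, x} \<or> (adjoins K)\<^sup>*\<^sup>* {a, b} {b, x}"
    proof (cases "touched a \<or> touched b")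
      case True
      then have "K a b x \<or> K b a x" using e adj.sym unfolding K_def by blast
      then have "adjoins K {a, b} {a, x} \<or> adjoins K {b, a} {b, x}"
        unfolding adjoins_def by blast
      then show ?thesis by (auto simp: insert_commute)
    next
      case False
      \<comment> \<open>The apex has two edges of one colour, which leaves no room for a common
        edge.\<close>
      have "\<not> touched x"
      proof
        assume "touched x"
        then obtain w where w: "common x w" unfolding touched_def by blast
        have xs: "adj (\<not> k) x a" "adj (\<not> k) x b" using e adj.sym by blast+
        then have "w \<noteq> a" "w \<noteq> b" using w common_not_adj by blast+
        moreover have "a \<noteq> b" using e adj.irrefl by metis
        ultimately show False
          using M_deg[of x w "\<not> k" a b] common_M[OF w] adj_M[OF xs(1)] adj_M[OF xs(2)] by blast
      qed
      then have "F.tri k a b x" using e False unfolding F.tri_def by blast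
      then have "(adjoins K')\<^sup>*\<^sup>* {a, b} {a, x} \<or> (adjoins K')\<^sup>*\<^sup>* {a, b} {b, x}"
        using K'(2) unfolding F.triangle_linked_def by blast
      then show ?thesis using adjoins_mono[of K' K] unfolding K_def by blast
    qed
  qed
  moreover have "K x a b" if "adj k x a" "adj (\<not> k) x b" "common a b" for k x a b
    using that unfolding K_def by blast
  ultimately show ?thesis by blast
qed

lemma adj_opposite: "adj k v a \<Longrightarrow> adj (\<not> k) v b \<Longrightarrow> opposite {v, a} {v, b}"
  unfolding adj_def opposite_def M_def by (auto split: if_splits)

lemma together_trans:
  assumes "trails S" "together S e f" "together S f g"
  shows "together S e g"
proof -
  obtain us vs where "us \<in> S" "e \<in> set (walk_edges us)" "f \<in> set (walk_edges us)"
    "vs \<in> S" "f \<in> set (walk_edges vs)" "g \<in> set (walk_edges vs)"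
    using assms(2,3) unfolding together_def by blast
  moreover have "us = vs"
    using assms(1) calculation unfolding trails_def by blast
  ultimately show ?thesis unfolding together_def by blast
qed

lemma ex_linked_trails:
  assumes K: "linking adj K"
  shows "\<exists>S. trails S \<and> (\<forall>e f. e \<in> R \<union> B \<longrightarrow> (adjoins K)\<^sup>*\<^sup>* e f \<longrightarrow> together S e f)"
proof -
  \<comment> \<open>Each link is listed once, with its red edge first, as
    \<open>trails_along\<close> requires.\<close>
  let ?L = "{(v, a, b). K v a b \<and> adj True v a}"
  have K1: "K v b a" "\<exists>k. adj k v a \<and> adj (\<not> k) v b" if "K v a b" for v a b
    using that K unfolding linking_def by blast+
  have K2: "b = c" if "K v a b" "K v a c" for v a b c
    using that K unfolding linking_def by blast
  have L: "adj True v a \<and> adj False v b" if "K v a b" "adj True v a" for v a b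
  proof -
    obtain k where k: "adj k v a" "adj (\<not> k) v b" using K1(2)[OF \<open>K v a b\<close>] by blast
    then have "k = True" using adj.colour_unique \<open>adj True v a\<close> by blast
    then show ?thesis using k by simp
  qed
  have RB: "{v, a} \<in> R \<and> {v, b} \<in> B" if "(v, a, b) \<in> ?L" for v a b
    using that L[of v a b] unfolding adj_def M_def by auto
  have "finite (\<Union>E)" using finE edge by fastforce
  then have "finite (\<Union>E \<times> \<Union>E \<times> \<Union>E)" by simp
  moreover have "?L \<subseteq> \<Union>E \<times> \<Union>E \<times> \<Union>E"
  proof
    fix l assume l: "l \<in> ?L"
    obtain v a b where v: "l = (v, a, b)" by (cases l)
    then have "{v, a} \<in> E" "{v, b} \<in> E" using RB l A1 A2 by blast+
    then show "l \<in> \<Union>E \<times> \<Union>E \<times> \<Union>E" using v by blast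
  qed
  ultimately have "finite ?L" by (rule finite_subset[rotated])
  then have "\<exists>S. trails S \<and> (\<forall>v a b. (v, a, b) \<in> ?L \<longrightarrow> together S {v, a} {v, b}) \<and>
    (\<forall>v a. {v, a} \<in> R \<union> B \<longrightarrow> (\<forall>b. (v, a, b) \<notin> ?L \<and> (v, b, a) \<notin> ?L) \<longrightarrow> (\<exists>us\<in>S. ends us v a))"
  proof (rule trails_along)
    show "{v, a} \<in> R \<and> {v, b} \<in> B" if "(v, a, b) \<in> ?L" for v a b by (rule RB[OF that])
    show "b = c" if "(v, a, b) \<in> ?L" "(v, a, c) \<in> ?L" for v a b c using K2 that by blast
    show "a = c" if "(v, a, b) \<in> ?L" "(v, c, b) \<in> ?L" for v a b c
      using K2[of v b a c] K1(1)[of v a b] K1(1)[of v c b] that by blast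
  qed
  then obtain S where S: "trails S" "\<And>v a b. (v, a, b) \<in> ?L \<Longrightarrow> together S {v, a} {v, b}"
    by blast
  have step: "together S e f" if "adjoins K e f" for e f
  proof -
    obtain v a b where v: "K v a b" "e = {v, a}" "f = {v, b}"
      using \<open>adjoins K e f\<close> unfolding adjoins_def by blast
    obtain k where k: "adj k v a" "adj (\<not> k) v b" using K1(2)[OF v(1)] by blast
    show ?thesis
    proof (cases k)
      case True
      then show ?thesis using S(2)[of v a b] k v by simp
    next
      case False
      then have "together S {v, b} {v, a}" using S(2)[of v b a] k K1(1)[OF v(1)] by simp
      then show ?thesis using v unfolding together_def by blast
    qed
  qed
  have "together S e f" if "(adjoins K)\<^sup>*\<^sup>* e f" "e \<in> R \<union> B" for e f
    using that(1)
  proof (induction rule: rtranclp_induct)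
    case base
    then show ?case using that(2) S(1) unfolding trails_def together_def by blast
  next
    case (step f g)
    then show ?case using together_trans[OF S(1)] \<open>\<And>e f. adjoins K e f \<Longrightarrow> together S e f\<close> by blast
  qed
  then show ?thesis using S(1) by blast
qed

text \<open>Such a triangle has a red and a blue edge. If the third edge is common, the forced link
  at the opposite vertex applies; otherwise \<open>triangle_linked\<close> does.\<close>

lemma ex_triangle_trails:
  "\<exists>S. trails S \<and> (\<forall>a b x. distinct [a, b, x] \<longrightarrow>
     (\<forall>T. T = {{a, b}, {b, x}, {x, a}} \<longrightarrow> T \<subseteq> A\<^sub>1 \<union> A\<^sub>2 \<longrightarrow> \<not> T \<subseteq> A\<^sub>1 \<longrightarrow> \<not> T \<subseteq> A\<^sub>2 \<longrightarrow>
       (\<exists>e\<in>T. \<exists>f\<in>T. opposite e f \<and> together S e f)))"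
proof -
  obtain K where K: "linking adj K" "adj.triangle_linked K"
    "\<And>k x a b. adj k x a \<Longrightarrow> adj (\<not> k) x b \<Longrightarrow> common a b \<Longrightarrow> K x a b"
    using ex_adj_linking by blast
  obtain S where S: "trails S"
    "\<And>e f. e \<in> R \<union> B \<Longrightarrow> (adjoins K)\<^sup>*\<^sup>* e f \<Longrightarrow> together S e f"
    using ex_linked_trails[OF K(1)] by blast
  define G where "G T \<longleftrightarrow> (\<exists>e\<in>T. \<exists>f\<in>T. opposite e f \<and> together S e f)" for T
  have RB: "{a, b} \<in> R \<union> B" if "adj k a b" for k a b
    using that unfolding adj_def M_def by (auto split: if_splits)
  have g1: "G {{a, b}, {b, x}, {x, a}}" if "adj k x a" "adj (\<not> k) x b" "common a b" for k a b x
  proof -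
    have "adjoins K {x, a} {x, b}" using K(3)[OF that] unfolding adjoins_def by blast
    then have "together S {x, a} {x, b}" using S(2) RB[OF that(1)] by blast
    then show ?thesis using adj_opposite[OF that(1,2)] unfolding G_def by (auto simp: insert_commute)
  qed
  have g2: "G {{a, b}, {b, x}, {x, a}}" if t: "adj k a b" "adj (\<not> k) a x" "adj (\<not> k) b x" for k a b x
  proof -
    have "(adjoins K)\<^sup>*\<^sup>* {a, b} {a, x} \<or> (adjoins K)\<^sup>*\<^sup>* {a, b} {b, x}"
      using K(2) t unfolding adj.triangle_linked_def adj.tri_def by blast
    then have "together S {a, b} {a, x} \<or> together S {a, b} {b, x}"
      using S(2) RB[OF t(1)] by blast
    then show ?thesis
      using adj_opposite[OF t(1,2)] adj_opposite[OF adj.sym[OF t(1)] t(3)]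
      unfolding G_def by (auto simp: insert_commute)
  qed
  have "G T" if T: "T = {{a, b}, {b, x}, {x, a}}" "distinct [a, b, x]" "T \<subseteq> A\<^sub>1 \<union> A\<^sub>2"
    "\<not> T \<subseteq> A\<^sub>1" "\<not> T \<subseteq> A\<^sub>2" for a b x T
  proof -
    have status: "adj True u v \<or> adj False u v \<or> common u v" if "{u, v} \<in> A\<^sub>1 \<union> A\<^sub>2" "u \<noteq> v" for u v
      using that unfolding adj_def common_def M_def by auto
    have st: "adj True a b \<or> adj False a b \<or> common a b" "adj True b x \<or> adj False b x \<or> common b x"
      "adj True x a \<or> adj False x a \<or> common x a"
      using T status by auto
    have inc: "adj True u v \<Longrightarrow> {u, v} \<in> A\<^sub>1" "adj False u v \<Longrightarrow> {u, v} \<in> A\<^sub>2"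
      "common u v \<Longrightarrow> {u, v} \<in> A\<^sub>1" "common u v \<Longrightarrow> {u, v} \<in> A\<^sub>2" for u v
      unfolding adj_def common_def M_def by auto
    have rot: "{{b, x}, {x, a}, {a, b}} = T" "{{x, a}, {a, b}, {b, x}} = T"
      unfolding T(1) by auto
    \<comment> \<open>\<open>g1'\<close> and \<open>g2'\<close> list the three positions of the
      common edge and of the base.\<close>
    have g1': "G T" if "adj k x a \<and> adj (\<not> k) b x \<and> common a b \<or> adj k a b \<and> adj (\<not> k) x a \<and> common b x
      \<or> adj k b x \<and> adj (\<not> k) a b \<and> common x a" for k
      using that g1[of k x a b, folded T(1)] g1[of k a b x, unfolded rot] g1[of k b x a, unfolded rot]
        adj.sym[of "\<not> k" b x] adj.sym[of "\<not> k" x a] adj.sym[of "\<not> k" a b] by argo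
    have g2': "G T" if "adj k a b \<and> adj (\<not> k) x a \<and> adj (\<not> k) b x \<or>
       adj k b x \<and> adj (\<not> k) a b \<and> adj (\<not> k) x a \<or> adj k x a \<and> adj (\<not> k) b x \<and> adj (\<not> k) a b" for k
      using that g2[of k a b x, folded T(1)] g2[of k b x a, unfolded rot] g2[of k x a b, unfolded rot]
        adj.sym[of "\<not> k" b x] adj.sym[of "\<not> k" x a] adj.sym[of "\<not> k" a b] by argo
    have n: "\<not> ({a, b} \<in> A\<^sub>1 \<and> {b, x} \<in> A\<^sub>1 \<and> {x, a} \<in> A\<^sub>1)" "\<not> ({a, b} \<in> A\<^sub>2 \<and> {b, x} \<in> A\<^sub>2 \<and> {x, a} \<in> A\<^sub>2)"
      using T by auto
    show ?thesis
      using st n inc[of a b] inc[of b x] inc[of x a] g1'[of True] g1'[of False] g2'[of True] g2'[of False]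
      by (elim disjE) simp_all
  qed
  with S(1) show ?thesis
    by (intro exI[of _ S] conjI allI impI) (simp_all only: G_def)
qed

end

theorem theorem2:
  fixes V :: "'v set" and E :: "'v set set" and \<T> :: "'v set set set"
    and A\<^sub>1 A\<^sub>2 :: "'v set set"
  assumes "is_graph V E"
    and "\<forall>T\<in>\<T>. is_triangle E T"
    and "two_matching V E A\<^sub>1" and "tri_free \<T> A\<^sub>1"
    and "two_matching V E A\<^sub>2" and "tri_free \<T> A\<^sub>2"
  shows "\<exists>\<P>. partition_on (sym_diff A\<^sub>1 A\<^sub>2) \<P> \<and>
           (\<forall>P\<in>\<P>. alternating_trail_set E A\<^sub>1 A\<^sub>2 P \<and>
              (\<forall>A\<in>{A\<^sub>1, A\<^sub>2}. two_matching V E (sym_diff A P) \<and> tri_free \<T> (sym_diff A P)))"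
proof -
  have E: "finite V" "E \<subseteq> {{u, v} | u v. u \<in> V \<and> v \<in> V}"
    using assms(1) unfolding is_graph_def by auto
  have sub: "A\<^sub>1 \<subseteq> E" "A\<^sub>2 \<subseteq> E" and deg: "\<forall>v\<in>V. deg A\<^sub>1 v \<le> 2" "\<forall>v\<in>V. deg A\<^sub>2 v \<le> 2"
    using assms(3,5) unfolding two_matching_def by auto
  have "E \<subseteq> Pow V" using E(2) by auto
  then have "finite E" using E(1) by (meson finite_Pow_iff finite_subset)
  \<comment> \<open>The locale bounds degrees at every element of the type, also outside
    \<open>V\<close>.\<close>
  have outside: "deg A v = 0" if "v \<notin> V" "A \<subseteq> E" for A v
  proof -
    have "{e \<in> A. v \<in> e} = {}" "{e \<in> A. e = {v}} = {}" using that \<open>E \<subseteq> Pow V\<close> by auto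
    then show ?thesis unfolding deg_def by (simp only: card.empty)
  qed
  interpret two_matchings E A\<^sub>1 A\<^sub>2
  proof
    show "finite E" "A\<^sub>1 \<subseteq> E" "A\<^sub>2 \<subseteq> E" by fact+
    show "\<exists>u v. e = {u, v}" if "e \<in> E" for e using that E(2) by blast
    show "deg A\<^sub>1 v \<le> 2" "deg A\<^sub>2 v \<le> 2" for v
      using deg outside[of v] sub by (cases "v \<in> V"; simp)+
  qed
  obtain S\<^sub>0 where S0: "trails S\<^sub>0"
    "\<And>a b x T. distinct [a, b, x] \<Longrightarrow> T = {{a, b}, {b, x}, {x, a}} \<Longrightarrow> T \<subseteq> A\<^sub>1 \<union> A\<^sub>2 \<Longrightarrow>
       \<not> T \<subseteq> A\<^sub>1 \<Longrightarrow> \<not> T \<subseteq> A\<^sub>2 \<Longrightarrow> \<exists>e\<in>T. \<exists>f\<in>T. opposite e f \<and> together S\<^sub>0 e f"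
    using ex_triangle_trails by (elim exE conjE) simp
  obtain S where S: "trails S" "\<And>e f. together S\<^sub>0 e f \<Longrightarrow> together S e f"
    "\<forall>us\<in>S. \<forall>vs\<in>S. \<forall>v a b. us \<noteq> vs \<longrightarrow> ends us v a \<longrightarrow> ends vs v b \<longrightarrow> \<not> opposite {v, a} {v, b}"
    using ex_unmergeable_trails[OF S0(1)] by (elim exE conjE) simp
  let ?edges = "\<lambda>us. set (walk_edges us)"
  have alt: "alt_trail us" if "us \<in> S" for us using S(1) that unfolding trails_def by simp
  have RB: "?edges us \<subseteq> R \<union> B" "?edges us \<noteq> {}" if "us \<in> S" for us
    using alt[OF that] unfolding alt_trail_iff by (simp, cases us rule: walk_edges.cases) auto
  have disj: "?edges us \<inter> ?edges vs = {}" if "us \<in> S" "vs \<in> S" "us \<noteq> vs" for us vs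
    using S(1) that unfolding trails_def by simp
  have "partition_on (sym_diff A\<^sub>1 A\<^sub>2) (?edges ` S)"
  proof (rule partition_onI)
    have "(\<Union>us\<in>S. ?edges us) \<subseteq> R \<union> B" using RB(1) by blast
    moreover have "R \<union> B \<subseteq> (\<Union>us\<in>S. ?edges us)" using S(1) unfolding trails_def by simp
    ultimately show "\<Union>(?edges ` S) = sym_diff A\<^sub>1 A\<^sub>2" by blast
    show "{} \<notin> ?edges ` S" using RB(2) by blast
    show "disjnt P Q" if PQ: "P \<in> ?edges ` S" "Q \<in> ?edges ` S" "P \<noteq> Q" for P Q
    proof -
      obtain us vs where "us \<in> S" "P = ?edges us" "vs \<in> S" "Q = ?edges vs" using PQ(1,2) by blast
      then show ?thesis using disj[of us vs] PQ(3) unfolding disjnt_def by auto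
    qed
  qed
  moreover have "alternating_trail_set E A\<^sub>1 A\<^sub>2 (?edges us)" if "us \<in> S" for us
    using alt[OF that] unfolding alt_trail_def alternating_trail_set_def by blast
  moreover have "two_matching V E (sym_diff A (?edges us))"
    if us: "us \<in> S" and A: "A \<in> {A\<^sub>1, A\<^sub>2}" for us A
    unfolding two_matching_def
  proof (intro conjI ballI)
    show "sym_diff A (?edges us) \<subseteq> E" using RB(1)[OF us] A sub by blast
    show "deg (sym_diff A (?edges us)) v \<le> 2" for v
      using deg_unmergeable[OF S(1) us S(3) A, of v] deg1[of v] deg2[of v] by simp
  qed
  moreover have "tri_free \<T> (sym_diff A (?edges us))"
    if us: "us \<in> S" and A: "A \<in> {A\<^sub>1, A\<^sub>2}" for us A
    unfolding tri_free_def
  proof (intro ballI notI)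
    fix T assume T: "T \<in> \<T>" "T \<subseteq> sym_diff A (?edges us)"
    have "is_triangle E T" using assms(2) T(1) by simp
    then obtain a b x where abx: "distinct [a, b, x]" "T = {{a, b}, {b, x}, {x, a}}"
      unfolding is_triangle_def by (elim exE conjE)
    have "sym_diff A (?edges us) \<subseteq> A\<^sub>1 \<union> A\<^sub>2" using RB(1)[OF us] A by auto
    with T(2) have "T \<subseteq> A\<^sub>1 \<union> A\<^sub>2" by (rule order_trans)
    moreover have "\<not> T \<subseteq> A\<^sub>1" "\<not> T \<subseteq> A\<^sub>2" using assms(4,6) T(1) unfolding tri_free_def by simp_all
    ultimately have "\<exists>e\<in>T. \<exists>f\<in>T. opposite e f \<and> together S\<^sub>0 e f" by (rule S0(2)[OF abx])
    then obtain e f where ef: "e \<in> T" "f \<in> T" "opposite e f" "together S e f"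
      using S(2) by blast
    obtain vs where vs: "vs \<in> S" "e \<in> ?edges vs" "f \<in> ?edges vs"
      using ef(4) unfolding together_def by blast
    \<comment> \<open>Switching \<open>us\<close> affects both \<open>e\<close> and \<open>f\<close>
      or neither; as their colours differ, exactly one of them is in the switched set.\<close>
    have "e \<in> ?edges us \<longleftrightarrow> f \<in> ?edges us"
      using disj[OF us vs(1)] vs by (cases "us = vs") auto
    moreover have "e \<in> sym_diff A (?edges us)" "f \<in> sym_diff A (?edges us)" using ef(1,2) T(2) by auto
    ultimately show False using ef(3) A unfolding opposite_def by auto
  qed
  ultimately show ?thesis by (intro exI[of _ "?edges ` S"]) blast
qed

end
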